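(* Let $s,r\in\mathbb N_+$, $\lambda\in\mathbb R$, and let $(a^{(\ell)}_{ij})_{i,j=1}^s,(b^{(\ell)}_i)_{i=1}^s$ for $\ell=1,2,3$ and $(\tilde a_{mi})_{m,i=1}^r,(\tilde b_m)_{m=1}^r$ be real Runge--Kutta coefficients. Consider the splitting Runge--Kutta method for the stochastic Maxwell equation given, for $1\le k,l,n\le s$ and $1\le m\le r$, and for $\mathbf X$ standing for each of $\mathbf H$ and $\mathbf E$, by the spatial relations \begin{align*} &\mathscr D_1\mathbf X^m_{kln}=\mathscr D_1\mathbf X^m_{0ln}+\Delta x\sum_{j=1}^sa^{(1)}_{kj}\mathscr D_1(\delta_x\mathbf X)^m_{jln},\qquad \mathscr D_1\overline{\mathbf X}^m_{1ln}=\mathscr D_1\mathbf X^m_{0ln}+\Delta x\sum_{k=1}^sb^{(1)}_k\mathscr D_1(\delta_x\mathbf X)^m_{kln},\\ &\mathscr D_2\mathbf X^m_{kln}=\mathscr D_2\mathbf X^m_{k0n}+\Delta y\sum_{j=1}^sa^{(2)}_{lj}\mathscr D_2(\delta_y\mathbf X)^m_{kjn},\qquad \mathscr D_2\overline{\mathbf X}^m_{k1n}=\mathscr D_2\mathbf X^m_{k0n}+\Delta y\sum_{l=1}^sb^{(2)}_l\mathscr D_2(\delta_y\mathbf X)^m_{kln},\\ &\mathscr D_3\mathbf X^m_{kln}=\mathscr D_3\mathbf X^m_{kl0}+\Delta z\sum_{j=1}^sa^{(3)}_{nj}\mathscr D_3(\delta_z\mathbf X)^m_{klj},\qquad \mathscr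 D_3\overline{\mathbf X}^m_{kl1}=\mathscr D_3\mathbf X^m_{kl0}+\Delta z\sum_{n=1}^sb^{(3)}_n\mathscr D_3(\delta_z\mathbf X)^m_{kln},\\ &\mathscr D_1\mathbf X^m_{1ln}=\mathscr D_1\overline{\mathbf X}^m_{1ln},\qquad \mathscr D_2\mathbf X^m_{k1n}=\mathscr D_2\overline{\mathbf X}^m_{k1n},\qquad \mathscr D_3\mathbf X^m_{kl1}=\mathscr D_3\overline{\mathbf X}^m_{kl1}, \end{align*} and the temporal relations, with $C(\mathbf X)^m_{kln}:=\mathscr D_1(\delta_x\mathbf X)^m_{kln}+\mathscr D_2(\delta_y\mathbf X)^m_{kln}+\mathscr D_3(\delta_z\mathbf X)^m_{kln}$, \begin{align*} &\mathbf H^m_{kln}=\mathbf H^0_{kln}-\Delta t\sum_{i=1}^r\tilde a_{mi}\,C(\mathbf E)^i_{kln},\qquad \mathbf E^m_{kln}=\mathbf E^0_{kln}+\Delta t\sum_{i=1}^r\tilde a_{mi}\,C(\mathbf H)^i_{kln},\\ &\overline{\mathbf H}^1_{kln}=\mathbf H^0_{kln}-\Delta t\sum_{m=1}^r\tilde b_m\,C(\mathbf E)^m_{kln},\qquad \overline{\mathbf E}^1_{kln}=\mathbf E^0_{kln}+\Delta t\sum_{m=1}^r\tilde b_m\,C(\mathbf H)^m_{kln},\\ &\mathbf E^1_{kln}=\overline{\mathbf E}^1_{kln}-\lambda\overline{\mathbf H}^1_{kln}\,\Delta W^1_{kln},\qquad \mathbf H^1_{kln}=\overline{\mathbf H}^1_{kln}+\lambda\mathbf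 E^1_{kln}\,\Delta W^1_{kln}. \end{align*} Assume the symplectic condition $$b^{(\ell)}_ib^{(\ell)}_j-b^{(\ell)}_ia^{(\ell)}_{ij}-b^{(\ell)}_ja^{(\ell)}_{ji}=0\quad(1\le i,j\le s,\ \ell=1,2,3),\qquad \tilde b_m\tilde b_i-\tilde b_m\tilde a_{mi}-\tilde b_i\tilde a_{im}=0\quad(1\le m,i\le r).$$ Then the method preserves, almost surely, the discrete multi-symplectic conservation law \begin{align*} &\frac1{\Delta t}\sum_{k,l,n=1}^sb^{(1)}_kb^{(2)}_lb^{(3)}_n\big(\mathrm d\mathbf E^1_{kln}\wedge\mathrm d\mathbf H^1_{kln}-\mathrm d\mathbf E^0_{kln}\wedge\mathrm d\mathbf H^0_{kln}\big)\\ &+\frac1{2\Delta x}\sum_{m=1}^r\sum_{l,n=1}^s\tilde b_mb^{(2)}_lb^{(3)}_n\big(\mathrm d\mathbf U^m_{1ln}\wedge K_1\mathrm d\mathbf U^m_{1ln}-\mathrm d\mathbf U^m_{0ln}\wedge K_1\mathrm d\mathbf U^m_{0ln}\big)\\ &+\frac1{2\Delta y}\sum_{m=1}^r\sum_{k,n=1}^s\tilde b_mb^{(1)}_kb^{(3)}_n\big(\mathrm d\mathbf U^m_{k1n}\wedge K_2\mathrm d\mathbf U^m_{k1n}-\mathrm d\mathbf U^m_{k0n}\wedge K_2\mathrm d\mathbf U^m_{k0n}\big)\\ &+\frac1{2\Delta z}\sum_{m=1}^r\sum_{k,l=1}^s\tilde b_mb^{(1)}_kb^{(2)}_l\big(\mathrm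 d\mathbf U^m_{kl1}\wedge K_3\mathrm d\mathbf U^m_{kl1}-\mathrm d\mathbf U^m_{kl0}\wedge K_3\mathrm d\mathbf U^m_{kl0}\big)=0, \end{align*} where $\mathbf U=(\mathbf H^\top,\mathbf E^\top)^\top$ with the same indices.
   Context: The stochastic Maxwell equation with multiplicative noise is $d\mathbf E=\nabla\times\mathbf H\,dt-\lambda\mathbf H\circ dW(t)$, $d\mathbf H=-\nabla\times\mathbf E\,dt+\lambda\mathbf E\circ dW(t)$, with $\mathbf E,\mathbf H$ $\mathbb R^3$-valued and $W$ a real $L^2$-valued $Q$-Wiener process with trace-class $Q$. Matrices: $$\mathscr D_1=\begin{pmatrix}0&0&0\\0&0&-1\\0&1&0\end{pmatrix},\quad \mathscr D_2=\begin{pmatrix}0&0&1\\0&0&0\\-1&0&0\end{pmatrix},\quad \mathscr D_3=\begin{pmatrix}0&-1&0\\1&0&0\\0&0&0\end{pmatrix},\quad K_i=\begin{pmatrix}\mathscr D_i&0\\0&\mathscr D_i\end{pmatrix},$$ so that $\nabla\times\mathbf X=\mathscr D_1\mathbf X_x+\mathscr D_2\mathbf X_y+\mathscr D_3\mathbf X_z$. The method treats one cell $[0,\Delta x]\times[0,\Delta y]\times[0,\Delta z]\times[0,\Delta t]$: the deterministic part is discretized by Runge--Kutta methods, the remaining stochastic part by the symplectic Euler method. All quantities are vectors in $\mathbb R^3$ (or $\mathbb R^6$ for $\mathbf U$) for each realization of the noise. $\mathbf X^m_{kln}$ (with $m$ a temporal stage index) approximates $\mathbf X$ at the stage point $(c^{(1)}_k\Delta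 x,c^{(2)}_l\Delta y,c^{(3)}_n\Delta z,\tilde c_m\Delta t)$, where $c^{(\ell)}_k=\sum_ja^{(\ell)}_{kj}$, $\tilde c_m=\sum_i\tilde a_{mi}$; $(\delta_x\mathbf X)^m_{kln}$, $(\delta_y\mathbf X)^m_{kln}$, $(\delta_z\mathbf X)^m_{kln}$ are the stage quantities discretizing the partial derivatives. $\mathbf X^0_{kln},\mathbf X^1_{kln},\overline{\mathbf X}^1_{kln}$ refer to times $0,\Delta t,\Delta t$ at the spatial stage point; $\mathbf X^m_{0ln},\mathbf X^m_{1ln},\overline{\mathbf X}^m_{1ln}$ refer to $x=0,\Delta x,\Delta x$ and temporal stage $m$, and analogously for the $y$- and $z$-indices. Boundary values with index $0$ or $1$ are families distinct from the stage values even if indices coincide numerically. $\Delta W^1_{kln}$ is the increment of $W$ over $[0,\Delta t]$ at the spatial stage point $(k,l,n)$. $\mathrm d$ (roman) is the exterior derivative: for a fixed realization of the noise, all numerical quantities are regarded as differentiable functions of parameters (e.g. the data), so their differentials satisfy the linearized scheme and noise increments carry no differential. $\mathrm d\mathbf E\wedge\mathrm d\mathbf H=\sum_{i=1}^3\mathrm dE_i\wedge\mathrm dH_i$ and $\mathrm d\mathbf U\wedge K\mathrm d\mathbf U=\sum_{p,q}K_{pq}\,\mathrm dU_p\wedge\mathrm dU_q$. Note that the latter, for $K=K_i$, involves only the components of $\mathbf U$ determined by $\mathscr D_i\mathbf H$ and $\mathscr D_i\mathbf E$. *)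

theory Defs
  imports "HOL-Probability.Probability"
begin

section \<open>The \<open>Q\<close>-Wiener process with values in \<open>L\<^sup>2(D)\<close>\<close>

text \<open>
  Elements of \<open>L\<^sup>2(D)\<close> are handled through representatives, i.e. functions on \<open>\<real>\<^sup>3\<close>; only
  their values on \<open>D\<close> matter, and only up to Lebesgue null sets.
\<close>

definition L2_set :: "(real^3) set \<Rightarrow> (real^3 \<Rightarrow> real) set" where
  "L2_set D = {f. f \<in> borel_measurable (lebesgue_on D) \<and>
                  integrable (lebesgue_on D) (\<lambda>x. (f x)\<^sup>2)}"

definition L2_inner :: "(real^3) set \<Rightarrow> (real^3 \<Rightarrow> real) \<Rightarrow> (real^3 \<Rightarrow> real) \<Rightarrow> real" where
  "L2_inner D f g = (LINT x|lebesgue_on D. f x * g x)"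

definition L2_norm :: "(real^3) set \<Rightarrow> (real^3 \<Rightarrow> real) \<Rightarrow> real" where
  "L2_norm D f = sqrt (L2_inner D f f)"

definition L2_open :: "(real^3) set \<Rightarrow> (real^3 \<Rightarrow> real) set \<Rightarrow> bool" where
  "L2_open D U \<longleftrightarrow> U \<subseteq> L2_set D \<and>
     (\<forall>f\<in>U. \<exists>e>0. \<forall>g\<in>L2_set D. L2_norm D (\<lambda>x. g x - f x) < e \<longrightarrow> g \<in> U)"

definition L2_borel :: "(real^3) set \<Rightarrow> (real^3 \<Rightarrow> real) measure" where
  "L2_borel D = sigma (L2_set D) {U. L2_open D U}"

definition L2_orthonormal_basis :: "(real^3) set \<Rightarrow> (nat \<Rightarrow> real^3 \<Rightarrow> real) \<Rightarrow> bool" where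
  "L2_orthonormal_basis D e \<longleftrightarrow>
     (\<forall>i. e i \<in> L2_set D) \<and>
     (\<forall>i j. L2_inner D (e i) (e j) = (if i = j then 1 else 0)) \<and>
     (\<forall>f\<in>L2_set D. (\<forall>i. L2_inner D f (e i) = 0) \<longrightarrow> (AE x in lebesgue_on D. f x = 0))"

text \<open>
  Linear, symmetric, nonnegative and trace class (boundedness follows from symmetry, and for a
  nonnegative \<open>Q\<close> the trace-class condition is that of a finite trace since \<open>\<bar>Q\<bar> = Q\<close>).
\<close>

definition trace_class_covariance ::
    "(real^3) set \<Rightarrow> ((real^3 \<Rightarrow> real) \<Rightarrow> (real^3 \<Rightarrow> real)) \<Rightarrow> bool" where
  "trace_class_covariance D Q \<longleftrightarrow>
     (\<forall>f\<in>L2_set D. Q f \<in> L2_set D) \<and>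
     (\<forall>f\<in>L2_set D. \<forall>g\<in>L2_set D. \<forall>c.
        AE x in lebesgue_on D. Q (\<lambda>y. c * f y + g y) x = c * Q f x + Q g x) \<and>
     (\<forall>f\<in>L2_set D. \<forall>g\<in>L2_set D. L2_inner D (Q f) g = L2_inner D f (Q g)) \<and>
     (\<forall>f\<in>L2_set D. 0 \<le> L2_inner D (Q f) f) \<and>
     (\<forall>e. L2_orthonormal_basis D e \<longrightarrow> summable (\<lambda>j. L2_inner D (Q (e j)) (e j)))"

text \<open>The centred normal law of variance \<open>v\<close>, a Dirac mass if \<open>v = 0\<close>.\<close>

definition centred_normal :: "real \<Rightarrow> real measure" where
  "centred_normal v =
     (if v = 0 then return borel 0 else density lborel (normal_density 0 (sqrt v)))"

text \<open>
  The four clauses after measurability: \<open>W(0) = 0\<close>; paths continuous in \<open>L\<^sup>2(D)\<close>; independent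
  increments; and \<open>W(t) - W(s)\<close> has the law \<open>N(0, (t - s) Q)\<close> on \<open>L\<^sup>2(D)\<close>, i.e. every
  \<open>\<langle>W(t) - W(s), h\<rangle>\<close> is centred normal of variance \<open>(t - s) \<langle>Q h, h\<rangle>\<close>.
\<close>

definition Q_Wiener_process ::
    "'w measure \<Rightarrow> (real^3) set \<Rightarrow> ((real^3 \<Rightarrow> real) \<Rightarrow> (real^3 \<Rightarrow> real)) \<Rightarrow>
     (real \<Rightarrow> 'w \<Rightarrow> real^3 \<Rightarrow> real) \<Rightarrow> bool" where
  "Q_Wiener_process M D Q W \<longleftrightarrow>
     (\<forall>t\<ge>0. W t \<in> measurable M (L2_borel D)) \<and>
     (AE \<omega> in M. AE x in lebesgue_on D. W 0 \<omega> x = 0) \<and>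
     (AE \<omega> in M. \<forall>t\<ge>0.
        ((\<lambda>s. L2_norm D (\<lambda>x. W s \<omega> x - W t \<omega> x)) \<longlongrightarrow> 0) (at t within {0..})) \<and>
     (\<forall>t :: nat \<Rightarrow> real. 0 \<le> t 0 \<and> mono t \<longrightarrow>
        prob_space.indep_vars M (\<lambda>i. L2_borel D)
          (\<lambda>i \<omega> x. W (t (Suc i)) \<omega> x - W (t i) \<omega> x) UNIV) \<and>
     (\<forall>s t. 0 \<le> s \<and> s \<le> t \<longrightarrow> (\<forall>h\<in>L2_set D.
        distr M borel (\<lambda>\<omega>. L2_inner D (\<lambda>x. W t \<omega> x - W s \<omega> x) h) =
        centred_normal ((t - s) * L2_inner D (Q h) h)))"


section \<open>The matrices\<close>

definition D1 :: "real^3^3" where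
  "D1 = vector [vector [0, 0, 0], vector [0, 0, -1], vector [0, 1, 0]]"

definition D2 :: "real^3^3" where
  "D2 = vector [vector [0, 0, 1], vector [0, 0, 0], vector [-1, 0, 0]]"

definition D3 :: "real^3^3" where
  "D3 = vector [vector [0, -1, 0], vector [1, 0, 0], vector [0, 0, 0]]"

text \<open>\<open>\<real>\<^sup>6\<close> is \<open>real^(3 + 3)\<close>: the index type is the disjoint sum of two copies of the index type 3.\<close>

definition block_diag :: "real^3^3 \<Rightarrow> real^(3 + 3)^(3 + 3)" where
  "block_diag A = (\<chi> p q. case (p, q) of
      (Inl i, Inl j) \<Rightarrow> A $ i $ j
    | (Inr i, Inr j) \<Rightarrow> A $ i $ j
    | _ \<Rightarrow> 0)"

definition K1 :: "real^(3 + 3)^(3 + 3)" where "K1 = block_diag D1"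
definition K2 :: "real^(3 + 3)^(3 + 3)" where "K2 = block_diag D2"
definition K3 :: "real^(3 + 3)^(3 + 3)" where "K3 = block_diag D3"

definition stack :: "real^3 \<Rightarrow> real^3 \<Rightarrow> real^(3 + 3)" where
  "stack h e = (\<chi> p. case p of Inl i \<Rightarrow> h $ i | Inr i \<Rightarrow> e $ i)"


section \<open>The numerical quantities and the scheme\<close>

text \<open>
  All quantities attached to one field \<open>X\<close> on the cell. The argument order is that of the
  indices, superscript first:

    \<^item> \<open>stage X m k l n\<close> is \<open>X\<^sup>m\<close> at \<open>k l n\<close>, and \<open>del_x\<close>, \<open>del_y\<close>, \<open>del_z\<close> are the stage derivatives;
    \<^item> \<open>x0 X m l n\<close>, \<open>x1 X m l n\<close>, \<open>x1_bar X m l n\<close> are \<open>X\<^sup>m\<close> at \<open>0 l n\<close>, \<open>1 l n\<close>, and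
      the barred value at \<open>1 l n\<close>;
    \<^item> \<open>y0 X m k n\<close>, \<dots> and \<open>z0 X m k l\<close>, \<dots> likewise in the second and third spatial index;
    \<^item> \<open>t0 X k l n\<close>, \<open>t1 X k l n\<close>, \<open>t1_bar X k l n\<close> are the values at the initial time, the final
      time, and the barred value at the final time.
\<close>

record cell_field =
  stage :: "nat \<Rightarrow> nat \<Rightarrow> nat \<Rightarrow> nat \<Rightarrow> real^3"
  del_x :: "nat \<Rightarrow> nat \<Rightarrow> nat \<Rightarrow> nat \<Rightarrow> real^3"
  del_y :: "nat \<Rightarrow> nat \<Rightarrow> nat \<Rightarrow> nat \<Rightarrow> real^3"
  del_z :: "nat \<Rightarrow> nat \<Rightarrow> nat \<Rightarrow> nat \<Rightarrow> real^3"
  x0 :: "nat \<Rightarrow> nat \<Rightarrow> nat \<Rightarrow> real^3"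
  x1 :: "nat \<Rightarrow> nat \<Rightarrow> nat \<Rightarrow> real^3"
  x1_bar :: "nat \<Rightarrow> nat \<Rightarrow> nat \<Rightarrow> real^3"
  y0 :: "nat \<Rightarrow> nat \<Rightarrow> nat \<Rightarrow> real^3"
  y1 :: "nat \<Rightarrow> nat \<Rightarrow> nat \<Rightarrow> real^3"
  y1_bar :: "nat \<Rightarrow> nat \<Rightarrow> nat \<Rightarrow> real^3"
  z0 :: "nat \<Rightarrow> nat \<Rightarrow> nat \<Rightarrow> real^3"
  z1 :: "nat \<Rightarrow> nat \<Rightarrow> nat \<Rightarrow> real^3"
  z1_bar :: "nat \<Rightarrow> nat \<Rightarrow> nat \<Rightarrow> real^3"
  t0 :: "nat \<Rightarrow> nat \<Rightarrow> nat \<Rightarrow> real^3"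
  t1 :: "nat \<Rightarrow> nat \<Rightarrow> nat \<Rightarrow> real^3"
  t1_bar :: "nat \<Rightarrow> nat \<Rightarrow> nat \<Rightarrow> real^3"

text \<open>
  The spatial coefficients are \<open>a d i j\<close> and \<open>b d i\<close> with the direction \<open>d \<in> {1, 2, 3}\<close>; the temporal ones are
  \<open>ta m i\<close> and \<open>tb m\<close>.
\<close>

definition spatial_relations ::
    "nat \<Rightarrow> nat \<Rightarrow> (nat \<Rightarrow> nat \<Rightarrow> nat \<Rightarrow> real) \<Rightarrow> (nat \<Rightarrow> nat \<Rightarrow> real) \<Rightarrow>
     real \<Rightarrow> real \<Rightarrow> real \<Rightarrow> cell_field \<Rightarrow> bool" where
  "spatial_relations s r a b dx dy dz X \<longleftrightarrow>
   (\<forall>m\<in>{1..r}. \<forall>k\<in>{1..s}. \<forall>l\<in>{1..s}. \<forall>n\<in>{1..s}.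
      D1 *v stage X m k l n = D1 *v x0 X m l n + dx *\<^sub>R (\<Sum>j=1..s. a 1 k j *\<^sub>R (D1 *v del_x X m j l n)) \<and>
      D2 *v stage X m k l n = D2 *v y0 X m k n + dy *\<^sub>R (\<Sum>j=1..s. a 2 l j *\<^sub>R (D2 *v del_y X m k j n)) \<and>
      D3 *v stage X m k l n = D3 *v z0 X m k l + dz *\<^sub>R (\<Sum>j=1..s. a 3 n j *\<^sub>R (D3 *v del_z X m k l j))) \<and>
   (\<forall>m\<in>{1..r}. \<forall>l\<in>{1..s}. \<forall>n\<in>{1..s}.
      D1 *v x1_bar X m l n = D1 *v x0 X m l n + dx *\<^sub>R (\<Sum>k=1..s. b 1 k *\<^sub>R (D1 *v del_x X m k l n)) \<and>
      D1 *v x1 X m l n = D1 *v x1_bar X m l n) \<and>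
   (\<forall>m\<in>{1..r}. \<forall>k\<in>{1..s}. \<forall>n\<in>{1..s}.
      D2 *v y1_bar X m k n = D2 *v y0 X m k n + dy *\<^sub>R (\<Sum>l=1..s. b 2 l *\<^sub>R (D2 *v del_y X m k l n)) \<and>
      D2 *v y1 X m k n = D2 *v y1_bar X m k n) \<and>
   (\<forall>m\<in>{1..r}. \<forall>k\<in>{1..s}. \<forall>l\<in>{1..s}.
      D3 *v z1_bar X m k l = D3 *v z0 X m k l + dz *\<^sub>R (\<Sum>n=1..s. b 3 n *\<^sub>R (D3 *v del_z X m k l n)) \<and>
      D3 *v z1 X m k l = D3 *v z1_bar X m k l)"

definition discrete_curl :: "cell_field \<Rightarrow> nat \<Rightarrow> nat \<Rightarrow> nat \<Rightarrow> nat \<Rightarrow> real^3" where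
  "discrete_curl X m k l n =
     D1 *v del_x X m k l n + D2 *v del_y X m k l n + D3 *v del_z X m k l n"

definition temporal_relations ::
    "nat \<Rightarrow> nat \<Rightarrow> (nat \<Rightarrow> nat \<Rightarrow> real) \<Rightarrow> (nat \<Rightarrow> real) \<Rightarrow> real \<Rightarrow> real \<Rightarrow>
     (nat \<Rightarrow> nat \<Rightarrow> nat \<Rightarrow> real) \<Rightarrow> cell_field \<Rightarrow> cell_field \<Rightarrow> bool" where
  "temporal_relations s r ta tb dt lam dW H E \<longleftrightarrow>
   (\<forall>k\<in>{1..s}. \<forall>l\<in>{1..s}. \<forall>n\<in>{1..s}.
      (\<forall>m\<in>{1..r}.
         stage H m k l n = t0 H k l n - dt *\<^sub>R (\<Sum>i=1..r. ta m i *\<^sub>R discrete_curl E i k l n) \<and>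
         stage E m k l n = t0 E k l n + dt *\<^sub>R (\<Sum>i=1..r. ta m i *\<^sub>R discrete_curl H i k l n)) \<and>
      t1_bar H k l n = t0 H k l n - dt *\<^sub>R (\<Sum>m=1..r. tb m *\<^sub>R discrete_curl E m k l n) \<and>
      t1_bar E k l n = t0 E k l n + dt *\<^sub>R (\<Sum>m=1..r. tb m *\<^sub>R discrete_curl H m k l n) \<and>
      t1 E k l n = t1_bar E k l n - (lam * dW k l n) *\<^sub>R t1_bar H k l n \<and>
      t1 H k l n = t1_bar H k l n + (lam * dW k l n) *\<^sub>R t1 E k l n)"

definition stage_point ::
    "nat \<Rightarrow> (nat \<Rightarrow> nat \<Rightarrow> nat \<Rightarrow> real) \<Rightarrow> real \<Rightarrow> real \<Rightarrow> real \<Rightarrow> nat \<Rightarrow> nat \<Rightarrow> nat \<Rightarrow> real^3" where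
  "stage_point s a dx dy dz k l n =
     vector [(\<Sum>j=1..s. a 1 k j) * dx, (\<Sum>j=1..s. a 2 l j) * dy, (\<Sum>j=1..s. a 3 n j) * dz]"

definition noise_increment ::
    "(real \<Rightarrow> 'w \<Rightarrow> real^3 \<Rightarrow> real) \<Rightarrow> nat \<Rightarrow> (nat \<Rightarrow> nat \<Rightarrow> nat \<Rightarrow> real) \<Rightarrow>
     real \<Rightarrow> real \<Rightarrow> real \<Rightarrow> real \<Rightarrow> 'w \<Rightarrow> nat \<Rightarrow> nat \<Rightarrow> nat \<Rightarrow> real" where
  "noise_increment W s a dx dy dz dt \<omega> k l n =
     W dt \<omega> (stage_point s a dx dy dz k l n) - W 0 \<omega> (stage_point s a dx dy dz k l n)"

definition splitting_RK_scheme ::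
    "nat \<Rightarrow> nat \<Rightarrow> (nat \<Rightarrow> nat \<Rightarrow> nat \<Rightarrow> real) \<Rightarrow> (nat \<Rightarrow> nat \<Rightarrow> real) \<Rightarrow>
     (nat \<Rightarrow> nat \<Rightarrow> real) \<Rightarrow> (nat \<Rightarrow> real) \<Rightarrow> real \<Rightarrow> real \<Rightarrow> real \<Rightarrow> real \<Rightarrow> real \<Rightarrow>
     (nat \<Rightarrow> nat \<Rightarrow> nat \<Rightarrow> real) \<Rightarrow> cell_field \<Rightarrow> cell_field \<Rightarrow> bool" where
  "splitting_RK_scheme s r a b ta tb dx dy dz dt lam dW H E \<longleftrightarrow>
     spatial_relations s r a b dx dy dz H \<and>
     spatial_relations s r a b dx dy dz E \<and>
     temporal_relations s r ta tb dt lam dW H E"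

definition symplectic_condition :: "nat \<Rightarrow> (nat \<Rightarrow> nat \<Rightarrow> real) \<Rightarrow> (nat \<Rightarrow> real) \<Rightarrow> bool" where
  "symplectic_condition s a b \<longleftrightarrow>
     (\<forall>i\<in>{1..s}. \<forall>j\<in>{1..s}. b i * b j - b i * a i j - b j * a j i = 0)"


text \<open>\<open>U = (H, E)\<close> as a function of the parameter, for a family \<open>F\<close> of boundary values.\<close>

definition stack_at ::
    "(cell_field \<Rightarrow> nat \<Rightarrow> nat \<Rightarrow> nat \<Rightarrow> real^3) \<Rightarrow> ('p \<Rightarrow> cell_field) \<Rightarrow>
     ('p \<Rightarrow> cell_field) \<Rightarrow> nat \<Rightarrow> nat \<Rightarrow> nat \<Rightarrow> 'p \<Rightarrow> real^(3 + 3)" where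
  "stack_at F H E m i j q = stack (F (H q) m i j) (F (E q) m i j)"


section \<open>Differentials with respect to the parameters\<close>

text \<open>All quantities of one field depend differentiably on a parameter, at the parameter value \<open>p\<close>.\<close>

definition depends_differentiably ::
    "nat \<Rightarrow> nat \<Rightarrow> ('p::real_normed_vector \<Rightarrow> cell_field) \<Rightarrow> 'p \<Rightarrow> bool" where
  "depends_differentiably s r X p \<longleftrightarrow>
   (\<forall>F\<in>{stage, del_x, del_y, del_z}. \<forall>m\<in>{1..r}. \<forall>k\<in>{1..s}. \<forall>l\<in>{1..s}. \<forall>n\<in>{1..s}.
      (\<lambda>q. F (X q) m k l n) differentiable (at p)) \<and>
   (\<forall>F\<in>{x0, x1, x1_bar, y0, y1, y1_bar, z0, z1, z1_bar}.
    \<forall>m\<in>{1..r}. \<forall>i\<in>{1..s}. \<forall>j\<in>{1..s}.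
      (\<lambda>q. F (X q) m i j) differentiable (at p)) \<and>
   (\<forall>F\<in>{t0, t1, t1_bar}. \<forall>k\<in>{1..s}. \<forall>l\<in>{1..s}. \<forall>n\<in>{1..s}.
      (\<lambda>q. F (X q) k l n) differentiable (at p))"

definition differential :: "('p::real_normed_vector \<Rightarrow> real) \<Rightarrow> 'p \<Rightarrow> 'p \<Rightarrow> real" where
  "differential f p = frechet_derivative f (at p)"

definition wedge :: "('p \<Rightarrow> real) \<Rightarrow> ('p \<Rightarrow> real) \<Rightarrow> 'p \<Rightarrow> 'p \<Rightarrow> real" where
  "wedge \<alpha> \<beta> u v = \<alpha> u * \<beta> v - \<alpha> v * \<beta> u"

text \<open>
  \<open>dwedge X Y p u v\<close> is the 2-form \<open>dX \<and> dY\<close> and \<open>dwedge_mat K U p u v\<close> the 2-form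
  \<open>dU \<and> K dU\<close>, at the parameter \<open>p\<close> and evaluated on the tangent vectors \<open>u, v\<close>.
\<close>

definition dwedge ::
    "('p::real_normed_vector \<Rightarrow> real^'n) \<Rightarrow> ('p \<Rightarrow> real^'n) \<Rightarrow> 'p \<Rightarrow> 'p \<Rightarrow> 'p \<Rightarrow> real" where
  "dwedge X Y p u v =
     (\<Sum>i\<in>UNIV. wedge (differential (\<lambda>q. X q $ i) p) (differential (\<lambda>q. Y q $ i) p) u v)"

definition dwedge_mat ::
    "real^'n^'n \<Rightarrow> ('p::real_normed_vector \<Rightarrow> real^'n) \<Rightarrow> 'p \<Rightarrow> 'p \<Rightarrow> 'p \<Rightarrow> real" where
  "dwedge_mat K U p u v =
     (\<Sum>i\<in>UNIV. \<Sum>j\<in>UNIV. K $ i $ j *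
        wedge (differential (\<lambda>q. U q $ i) p) (differential (\<lambda>q. U q $ j) p) u v)"

end

theory Submission
  imports Defs
begin

text \<open>
  For a fixed realization the scheme is linear in the fields, so the differentials
  \<open>dH u\<close>, \<open>dE u\<close> along a tangent vector \<open>u\<close> satisfy the same scheme, with the same noise
  increments. A Runge--Kutta method with the symplectic condition maps bilinear forms exactly as the
  continuous flow does: \<open>B x y\<close> increases by the quadrature of \<open>B f y + B x g\<close>, where \<open>f\<close>, \<open>g\<close>
  are the stage slopes. In space this is applied to \<open>X \<bullet> D\<^sub>i Y\<close>, which depends only on \<open>D\<^sub>i X\<close> and
  \<open>D\<^sub>i Y\<close> as \<open>D\<^sub>i\<close> is skew, and in time to \<open>E \<bullet> H\<close>. The stochastic step is a composition of shears
  and leaves \<open>dE \<and> dH\<close> unchanged. By skewness of the \<open>D\<^sub>i\<close> the quadrature sums of the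
  temporal and the spatial increments cancel stage by stage.
\<close>

section \<open>Symplectic Runge--Kutta steps and bilinear forms\<close>

text \<open>Expanding \<open>B xb yb\<close> leaves terms of first order in \<open>h\<close>, paired
  with \<open>xa\<close> and \<open>ya\<close>, and a second-order double sum with weights
  \<open>w i * w j\<close>. Replacing \<open>ya\<close> and \<open>xa\<close> by the stage values
  produces double sums with weights \<open>w i * c i j\<close> and \<open>w j * c j i\<close>; the
  symplectic condition says exactly that these add up to \<open>w i * w j\<close>.\<close>

lemma bilinear_symplectic_RK_increment:
  fixes B :: "'a::real_normed_vector \<Rightarrow> 'b::real_normed_vector \<Rightarrow> 'c::real_normed_vector"
    and w :: "nat \<Rightarrow> real" and c :: "nat \<Rightarrow> nat \<Rightarrow> real"
  assumes B: "bounded_bilinear B"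
    and sym: "symplectic_condition N c w"
    and x: "\<And>i. i \<in> {1..N} \<Longrightarrow> x i = xa + h *\<^sub>R (\<Sum>j=1..N. c i j *\<^sub>R f j)"
    and y: "\<And>i. i \<in> {1..N} \<Longrightarrow> y i = ya + h *\<^sub>R (\<Sum>j=1..N. c i j *\<^sub>R g j)"
    and xb: "xb = xa + h *\<^sub>R (\<Sum>j=1..N. w j *\<^sub>R f j)"
    and yb: "yb = ya + h *\<^sub>R (\<Sum>j=1..N. w j *\<^sub>R g j)"
  shows "B xb yb - B xa ya = h *\<^sub>R (\<Sum>i=1..N. w i *\<^sub>R (B (f i) (y i) + B (x i) (g i)))"
proof -
  interpret bounded_bilinear B by (fact B)
  let ?S = "{1..N}"
  have fy: "(\<Sum>i\<in>?S. w i *\<^sub>R (B (f i) (y i))) =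
      (\<Sum>i\<in>?S. w i *\<^sub>R (B (f i) ya)) + h *\<^sub>R (\<Sum>i\<in>?S. \<Sum>j\<in>?S. (w i * c i j) *\<^sub>R (B (f i) (g j)))"
  proof -
    have "(\<Sum>i\<in>?S. w i *\<^sub>R (B (f i) (y i))) =
      (\<Sum>i\<in>?S. w i *\<^sub>R (B (f i) ya) + h *\<^sub>R (\<Sum>j\<in>?S. (w i * c i j) *\<^sub>R (B (f i) (g j))))"
      by (intro sum.cong refl)
        (simp add: y add_right scaleR_right sum_right scaleR_add_right scaleR_sum_right mult_ac)
    thus ?thesis by (simp add: sum.distrib scaleR_sum_right)
  qed
  \<comment> \<open>The stage index is called \<open>j\<close> here and the sums are swapped at the
    end, so that both corrections become double sums over the same terms
    \<open>B (f i) (g j)\<close>.\<close>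
  have xg: "(\<Sum>j\<in>?S. w j *\<^sub>R (B (x j) (g j))) =
      (\<Sum>j\<in>?S. w j *\<^sub>R (B xa (g j))) + h *\<^sub>R (\<Sum>i\<in>?S. \<Sum>j\<in>?S. (w j * c j i) *\<^sub>R (B (f i) (g j)))"
  proof -
    have "(\<Sum>j\<in>?S. w j *\<^sub>R (B (x j) (g j))) =
      (\<Sum>j\<in>?S. w j *\<^sub>R (B xa (g j)) + h *\<^sub>R (\<Sum>i\<in>?S. (w j * c j i) *\<^sub>R (B (f i) (g j))))"
      by (intro sum.cong refl)
        (simp add: x add_left scaleR_left sum_left scaleR_add_right scaleR_sum_right mult_ac)
    also have "\<dots> = (\<Sum>j\<in>?S. w j *\<^sub>R (B xa (g j))) +
        h *\<^sub>R (\<Sum>j\<in>?S. \<Sum>i\<in>?S. (w j * c j i) *\<^sub>R (B (f i) (g j)))"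
      by (simp add: sum.distrib scaleR_sum_right)
    finally show ?thesis by (subst sum.swap) simp
  qed
  have "(\<Sum>i\<in>?S. \<Sum>j\<in>?S. (w i * w j) *\<^sub>R (B (f i) (g j))) =
      (\<Sum>i\<in>?S. \<Sum>j\<in>?S. (w i * c i j) *\<^sub>R (B (f i) (g j)) + (w j * c j i) *\<^sub>R (B (f i) (g j)))"
  proof (intro sum.cong refl)
    fix i j assume "i \<in> ?S" "j \<in> ?S"
    hence "w i * w j = w i * c i j + w j * c j i"
      using sym by (force simp: symplectic_condition_def)
    thus "(w i * w j) *\<^sub>R (B (f i) (g j)) =
        (w i * c i j) *\<^sub>R (B (f i) (g j)) + (w j * c j i) *\<^sub>R (B (f i) (g j))"
      by (simp add: scaleR_add_left)
  qed
  hence ww: "(\<Sum>i\<in>?S. \<Sum>j\<in>?S. (w i * w j) *\<^sub>R (B (f i) (g j))) =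
      (\<Sum>i\<in>?S. \<Sum>j\<in>?S. (w i * c i j) *\<^sub>R (B (f i) (g j))) +
      (\<Sum>i\<in>?S. \<Sum>j\<in>?S. (w j * c j i) *\<^sub>R (B (f i) (g j)))"
    by (simp add: sum.distrib)
  have "B xb yb - B xa ya = h *\<^sub>R ((\<Sum>i\<in>?S. w i *\<^sub>R (B (f i) ya)) + (\<Sum>j\<in>?S. w j *\<^sub>R (B xa (g j)))
      + h *\<^sub>R (\<Sum>i\<in>?S. \<Sum>j\<in>?S. (w i * w j) *\<^sub>R (B (f i) (g j))))"
    unfolding xb yb
    by (simp add: add_left add_right scaleR_left scaleR_right sum_left sum_right
        scaleR_add_right scaleR_sum_right sum.distrib)
      (subst sum.swap, simp add: mult_ac)
  also have "\<dots> = h *\<^sub>R (\<Sum>i\<in>?S. w i *\<^sub>R (B (f i) (y i) + B (x i) (g i)))"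
    unfolding ww scaleR_add_right sum.distrib fy xg by (simp add: algebra_simps)
  finally show ?thesis .
qed

definition skew_matrix :: "real^'n^'n \<Rightarrow> bool" where
  "skew_matrix A \<longleftrightarrow> (\<forall>x y. x \<bullet> (A *v y) = - ((A *v x) \<bullet> y))"

lemma skew_matrix_D: "skew_matrix D1" "skew_matrix D2" "skew_matrix D3"
  by (simp_all add: skew_matrix_def D1_def D2_def D3_def inner_vec_def sum_3
      matrix_vector_mult_def algebra_simps)

text \<open>The scheme controls only the images under the singular matrices \<open>D1\<close>,
  \<open>D2\<close>, \<open>D3\<close>, so the vectors themselves need not satisfy Runge--Kutta
  relations. Skewness repairs this: \<open>x \<bullet> (A *v y)\<close> equals
  \<open>- ((A *v x) \<bullet> y)\<close>, so it is unchanged when \<open>x\<close> and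
  \<open>y\<close> are replaced by vectors with the same images under \<open>A\<close>.\<close>

lemma skew_symplectic_RK_increment:
  fixes A :: "real^'n^'n"
  assumes A: "skew_matrix A" and sym: "symplectic_condition N c w"
    and x: "\<And>i. i \<in> {1..N} \<Longrightarrow> A *v x i = A *v xa + h *\<^sub>R (\<Sum>j=1..N. c i j *\<^sub>R (A *v f j))"
    and y: "\<And>i. i \<in> {1..N} \<Longrightarrow> A *v y i = A *v ya + h *\<^sub>R (\<Sum>j=1..N. c i j *\<^sub>R (A *v g j))"
    and xb: "A *v xb = A *v xa + h *\<^sub>R (\<Sum>j=1..N. w j *\<^sub>R (A *v f j))"
    and yb: "A *v yb = A *v ya + h *\<^sub>R (\<Sum>j=1..N. w j *\<^sub>R (A *v g j))"
  shows "xb \<bullet> (A *v yb) - xa \<bullet> (A *v ya) =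
    h * (\<Sum>i=1..N. w i * (f i \<bullet> (A *v y i) + x i \<bullet> (A *v g i)))"
proof -
  have sk: "u \<bullet> (A *v v) = - ((A *v u) \<bullet> v)" for u v
    using A by (simp add: skew_matrix_def)
  have bil: "bounded_bilinear (\<lambda>u v. u \<bullet> (A *v v))"
    by (rule bounded_bilinear.comp[OF bounded_bilinear_inner bounded_linear_ident
          matrix_vector_mul_bounded_linear])
  \<comment> \<open>Substitutes that satisfy the full vector relations with the given initial values
    and slopes, and differ from the actual values only by elements of the kernel of
    \<open>A\<close>.\<close>
  define X where "X i = xa + h *\<^sub>R (\<Sum>j=1..N. c i j *\<^sub>R f j)" for i
  define Y where "Y i = ya + h *\<^sub>R (\<Sum>j=1..N. c i j *\<^sub>R g j)" for i
  define X1 where "X1 = xa + h *\<^sub>R (\<Sum>j=1..N. w j *\<^sub>R f j)"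
  define Y1 where "Y1 = ya + h *\<^sub>R (\<Sum>j=1..N. w j *\<^sub>R g j)"
  note lin = matrix_vector_right_distrib matrix_vector_mult_scaleR linear_sum[OF matrix_vector_mul_linear]
  have X: "A *v X i = A *v x i" and Y: "A *v Y i = A *v y i" if "i \<in> {1..N}" for i
    by (simp_all add: X_def Y_def x[OF that] y[OF that] lin)
  have X1: "A *v X1 = A *v xb" and Y1: "A *v Y1 = A *v yb"
    by (simp_all add: X1_def Y1_def xb yb lin)
  have "X1 \<bullet> (A *v Y1) - xa \<bullet> (A *v ya) =
      h *\<^sub>R (\<Sum>i=1..N. w i *\<^sub>R (f i \<bullet> (A *v Y i) + X i \<bullet> (A *v g i)))"
    by (rule bilinear_symplectic_RK_increment[OF bil sym]) (simp_all add: X_def Y_def X1_def Y1_def)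
  moreover have "X1 \<bullet> (A *v Y1) = xb \<bullet> (A *v yb)"
    by (metis X1 Y1 sk)
  moreover have "X i \<bullet> (A *v g i) = x i \<bullet> (A *v g i)" if "i \<in> {1..N}" for i
    by (metis X[OF that] sk)
  ultimately show ?thesis by (simp add: Y)
qed

section \<open>Linearization of the scheme\<close>

text \<open>The differentials along \<open>u\<close> are packed into a \<open>cell_field\<close>
  again, so that the predicates describing the scheme can be applied to them verbatim.\<close>

definition field_differential :: "('p::real_normed_vector \<Rightarrow> cell_field) \<Rightarrow> 'p \<Rightarrow> 'p \<Rightarrow> cell_field" where
  "field_differential X p u =
    (let d3 = (\<lambda>F i j k. frechet_derivative (\<lambda>q. F (X q) i j k) (at p) u);
         d4 = (\<lambda>F m i j k. frechet_derivative (\<lambda>q. F (X q) m i j k) (at p) u)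
     in \<lparr>stage = d4 stage, del_x = d4 del_x, del_y = d4 del_y, del_z = d4 del_z,
         x0 = d3 x0, x1 = d3 x1, x1_bar = d3 x1_bar,
         y0 = d3 y0, y1 = d3 y1, y1_bar = d3 y1_bar,
         z0 = d3 z0, z1 = d3 z1, z1_bar = d3 z1_bar,
         t0 = d3 t0, t1 = d3 t1, t1_bar = d3 t1_bar\<rparr>)"

lemma field_differential_simps:
  "stage (field_differential X p u) m k l n = frechet_derivative (\<lambda>q. stage (X q) m k l n) (at p) u"
  "del_x (field_differential X p u) m k l n = frechet_derivative (\<lambda>q. del_x (X q) m k l n) (at p) u"
  "del_y (field_differential X p u) m k l n = frechet_derivative (\<lambda>q. del_y (X q) m k l n) (at p) u"
  "del_z (field_differential X p u) m k l n = frechet_derivative (\<lambda>q. del_z (X q) m k l n) (at p) u"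
  "x0 (field_differential X p u) m l n = frechet_derivative (\<lambda>q. x0 (X q) m l n) (at p) u"
  "x1 (field_differential X p u) m l n = frechet_derivative (\<lambda>q. x1 (X q) m l n) (at p) u"
  "x1_bar (field_differential X p u) m l n = frechet_derivative (\<lambda>q. x1_bar (X q) m l n) (at p) u"
  "y0 (field_differential X p u) m l n = frechet_derivative (\<lambda>q. y0 (X q) m l n) (at p) u"
  "y1 (field_differential X p u) m l n = frechet_derivative (\<lambda>q. y1 (X q) m l n) (at p) u"
  "y1_bar (field_differential X p u) m l n = frechet_derivative (\<lambda>q. y1_bar (X q) m l n) (at p) u"
  "z0 (field_differential X p u) m l n = frechet_derivative (\<lambda>q. z0 (X q) m l n) (at p) u"
  "z1 (field_differential X p u) m l n = frechet_derivative (\<lambda>q. z1 (X q) m l n) (at p) u"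
  "z1_bar (field_differential X p u) m l n = frechet_derivative (\<lambda>q. z1_bar (X q) m l n) (at p) u"
  "t0 (field_differential X p u) m l n = frechet_derivative (\<lambda>q. t0 (X q) m l n) (at p) u"
  "t1 (field_differential X p u) m l n = frechet_derivative (\<lambda>q. t1 (X q) m l n) (at p) u"
  "t1_bar (field_differential X p u) m l n = frechet_derivative (\<lambda>q. t1_bar (X q) m l n) (at p) u"
  by (simp_all add: field_differential_def)

text \<open>Equality on a neighbourhood lets the derivative of \<open>g\<close> serve for
  \<open>f\<close>, and derivatives are unique. This is the device that linearizes each relation of
  the scheme.\<close>

lemma has_derivative_eq_on_open:
  assumes "open P" "p \<in> P" and eq: "\<And>q. q \<in> P \<Longrightarrow> f q = g q"
    and f: "(f has_derivative f') (at p)" and g: "(g has_derivative g') (at p)"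
  shows "f' u = g' u"
proof -
  have "(f has_derivative g') (at p)"
    by (rule has_derivative_transform_within_open[OF g assms(1,2)]) (simp add: eq)
  with f show ?thesis by (metis has_derivative_unique)
qed

lemmas has_derivative_matrix_vector_mult [derivative_intros] =
  bounded_linear.has_derivative[OF matrix_vector_mul_bounded_linear]

lemma depends_differentiablyD:
  assumes "depends_differentiably s r X p"
    and "m \<in> {1..r}" "k \<in> {1..s}" "l \<in> {1..s}" "n \<in> {1..s}"
  shows
    "((\<lambda>q. stage (X q) m k l n) has_derivative (\<lambda>u. stage (field_differential X p u) m k l n)) (at p)"
    "((\<lambda>q. del_x (X q) m k l n) has_derivative (\<lambda>u. del_x (field_differential X p u) m k l n)) (at p)"
    "((\<lambda>q. del_y (X q) m k l n) has_derivative (\<lambda>u. del_y (field_differential X p u) m k l n)) (at p)"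
    "((\<lambda>q. del_z (X q) m k l n) has_derivative (\<lambda>u. del_z (field_differential X p u) m k l n)) (at p)"
    "((\<lambda>q. x0 (X q) m l n) has_derivative (\<lambda>u. x0 (field_differential X p u) m l n)) (at p)"
    "((\<lambda>q. x1 (X q) m l n) has_derivative (\<lambda>u. x1 (field_differential X p u) m l n)) (at p)"
    "((\<lambda>q. x1_bar (X q) m l n) has_derivative (\<lambda>u. x1_bar (field_differential X p u) m l n)) (at p)"
    "((\<lambda>q. y0 (X q) m k n) has_derivative (\<lambda>u. y0 (field_differential X p u) m k n)) (at p)"
    "((\<lambda>q. y1 (X q) m k n) has_derivative (\<lambda>u. y1 (field_differential X p u) m k n)) (at p)"
    "((\<lambda>q. y1_bar (X q) m k n) has_derivative (\<lambda>u. y1_bar (field_differential X p u) m k n)) (at p)"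
    "((\<lambda>q. z0 (X q) m k l) has_derivative (\<lambda>u. z0 (field_differential X p u) m k l)) (at p)"
    "((\<lambda>q. z1 (X q) m k l) has_derivative (\<lambda>u. z1 (field_differential X p u) m k l)) (at p)"
    "((\<lambda>q. z1_bar (X q) m k l) has_derivative (\<lambda>u. z1_bar (field_differential X p u) m k l)) (at p)"
  unfolding field_differential_simps frechet_derivative_works[symmetric]
  using assms unfolding depends_differentiably_def ball_simps(5,7) by blast+

lemma discrete_curl_has_derivative:
  assumes "depends_differentiably s r X p"
    and "m \<in> {1..r}" "k \<in> {1..s}" "l \<in> {1..s}" "n \<in> {1..s}"
  shows "((\<lambda>q. discrete_curl (X q) m k l n) has_derivative
      (\<lambda>u. discrete_curl (field_differential X p u) m k l n)) (at p)"
  unfolding discrete_curl_def by (intro derivative_intros depends_differentiablyD[OF assms])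

lemma depends_differentiably_timeD:
  assumes "depends_differentiably s r X p" and "k \<in> {1..s}" "l \<in> {1..s}" "n \<in> {1..s}"
  shows
    "((\<lambda>q. t0 (X q) k l n) has_derivative (\<lambda>u. t0 (field_differential X p u) k l n)) (at p)"
    "((\<lambda>q. t1 (X q) k l n) has_derivative (\<lambda>u. t1 (field_differential X p u) k l n)) (at p)"
    "((\<lambda>q. t1_bar (X q) k l n) has_derivative (\<lambda>u. t1_bar (field_differential X p u) k l n)) (at p)"
  unfolding field_differential_simps frechet_derivative_works[symmetric]
  using assms unfolding depends_differentiably_def ball_simps(5,7) by blast+

lemma spatial_relations_field_differential:
  assumes P: "open P" "p \<in> P"
    and rel: "\<And>q. q \<in> P \<Longrightarrow> spatial_relations s r a b dx dy dz (X q)"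
    and diff: "depends_differentiably s r X p"
  shows "spatial_relations s r a b dx dy dz (field_differential X p u)"
  unfolding spatial_relations_def
  \<comment> \<open>Each relation is an equation between two functions of the parameter. The first
    alternative differentiates its two sides, the second supplies the equation on \<open>P\<close>
    from \<open>rel\<close>.\<close>
  by (intro conjI ballI;
      rule has_derivative_eq_on_open[OF P, where u = u];
      ((rule derivative_intros | rule depends_differentiablyD[OF diff] | assumption)+
       | (drule rel, simp add: spatial_relations_def)))

text \<open>For a fixed realization \<open>dW\<close> is constant in the parameter, so the noise
  step is linear in the fields and reappears unchanged for the differentials.\<close>

lemma temporal_relations_field_differential:
  assumes P: "open P" "p \<in> P"
    and rel: "\<And>q. q \<in> P \<Longrightarrow> temporal_relations s r ta tb dt lam dW (X q) (Y q)"
    and diff: "depends_differentiably s r X p" "depends_differentiably s r Y p"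
  shows "temporal_relations s r ta tb dt lam dW (field_differential X p u) (field_differential Y p u)"
  unfolding temporal_relations_def
  by (intro conjI ballI;
      rule has_derivative_eq_on_open[OF P, where u = u];
      ((rule derivative_intros depends_differentiablyD[OF diff(1)] depends_differentiablyD[OF diff(2)]
          discrete_curl_has_derivative[OF diff(1)] discrete_curl_has_derivative[OF diff(2)]
          depends_differentiably_timeD[OF diff(1)] depends_differentiably_timeD[OF diff(2)] | assumption)+
       | (drule rel, simp add: temporal_relations_def)))

section \<open>Increments of the fluxes and of the temporal form\<close>

text \<open>With \<open>F\<close> a stage derivative such as \<open>del_x\<close>, this is the
  Leibniz expression for the partial derivative of \<open>X \<bullet> (A *v Y)\<close> at a stage
  point.\<close>

definition flux_density ::
    "real^3^3 \<Rightarrow> (cell_field \<Rightarrow> nat \<Rightarrow> nat \<Rightarrow> nat \<Rightarrow> nat \<Rightarrow> real^3) \<Rightarrow> cell_field \<Rightarrow> cell_field \<Rightarrow>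
     nat \<Rightarrow> nat \<Rightarrow> nat \<Rightarrow> nat \<Rightarrow> real" where
  "flux_density A F X Y m k l n =
     F X m k l n \<bullet> (A *v stage Y m k l n) + stage X m k l n \<bullet> (A *v F Y m k l n)"

text \<open>The indices are rearranged: \<open>k\<close> always runs along the direction of the
  relation and \<open>i\<close>, \<open>j\<close> are transverse. The barred values are
  eliminated.\<close>

lemma spatial_relationsD:
  assumes "spatial_relations s r a b dx dy dz X" and "m \<in> {1..r}" "i \<in> {1..s}" "j \<in> {1..s}"
  shows
    "k \<in> {1..s} \<Longrightarrow>
      D1 *v stage X m k i j = D1 *v x0 X m i j + dx *\<^sub>R (\<Sum>n=1..s. a 1 k n *\<^sub>R (D1 *v del_x X m n i j))"
    "k \<in> {1..s} \<Longrightarrow>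
      D2 *v stage X m i k j = D2 *v y0 X m i j + dy *\<^sub>R (\<Sum>n=1..s. a 2 k n *\<^sub>R (D2 *v del_y X m i n j))"
    "k \<in> {1..s} \<Longrightarrow>
      D3 *v stage X m i j k = D3 *v z0 X m i j + dz *\<^sub>R (\<Sum>n=1..s. a 3 k n *\<^sub>R (D3 *v del_z X m i j n))"
    "D1 *v x1 X m i j = D1 *v x0 X m i j + dx *\<^sub>R (\<Sum>k=1..s. b 1 k *\<^sub>R (D1 *v del_x X m k i j))"
    "D2 *v y1 X m i j = D2 *v y0 X m i j + dy *\<^sub>R (\<Sum>k=1..s. b 2 k *\<^sub>R (D2 *v del_y X m i k j))"
    "D3 *v z1 X m i j = D3 *v z0 X m i j + dz *\<^sub>R (\<Sum>k=1..s. b 3 k *\<^sub>R (D3 *v del_z X m i j k))"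
  using assms by (simp_all add: spatial_relations_def)

lemma spatial_flux_increments:
  assumes X: "spatial_relations s r a b dx dy dz X" and Y: "spatial_relations s r a b dx dy dz Y"
    and sym: "symplectic_condition s (a 1) (b 1)" "symplectic_condition s (a 2) (b 2)"
      "symplectic_condition s (a 3) (b 3)"
    and m: "m \<in> {1..r}" and i: "i \<in> {1..s}" and j: "j \<in> {1..s}"
  shows
    "x1 X m i j \<bullet> (D1 *v x1 Y m i j) - x0 X m i j \<bullet> (D1 *v x0 Y m i j) =
      dx * (\<Sum>k=1..s. b 1 k * flux_density D1 del_x X Y m k i j)"
    "y1 X m i j \<bullet> (D2 *v y1 Y m i j) - y0 X m i j \<bullet> (D2 *v y0 Y m i j) =
      dy * (\<Sum>k=1..s. b 2 k * flux_density D2 del_y X Y m i k j)"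
    "z1 X m i j \<bullet> (D3 *v z1 Y m i j) - z0 X m i j \<bullet> (D3 *v z0 Y m i j) =
      dz * (\<Sum>k=1..s. b 3 k * flux_density D3 del_z X Y m i j k)"
  unfolding flux_density_def
  by (rule skew_symplectic_RK_increment[OF skew_matrix_D(1) sym(1)
        spatial_relationsD(1)[OF X m i j] spatial_relationsD(1)[OF Y m i j]
        spatial_relationsD(4)[OF X m i j] spatial_relationsD(4)[OF Y m i j]]
      skew_symplectic_RK_increment[OF skew_matrix_D(2) sym(2)
        spatial_relationsD(2)[OF X m i j] spatial_relationsD(2)[OF Y m i j]
        spatial_relationsD(5)[OF X m i j] spatial_relationsD(5)[OF Y m i j]]
      skew_symplectic_RK_increment[OF skew_matrix_D(3) sym(3)
        spatial_relationsD(3)[OF X m i j] spatial_relationsD(3)[OF Y m i j]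
        spatial_relationsD(6)[OF X m i j] spatial_relationsD(6)[OF Y m i j]]; assumption?)+

text \<open>With the unprimed fields as differentials along \<open>u\<close> and the primed ones
  along \<open>v\<close>, the bracketed differences are the values of the form
  \<open>dE \<and> dH\<close> on \<open>u\<close>, \<open>v\<close>. The noise step drops out, the
  Runge--Kutta step contributes pairings with discrete curls, and skewness turns these into flux
  densities.\<close>

lemma temporal_wedge_increment:
  assumes U: "temporal_relations s r ta tb dt lam dW H E"
    and V: "temporal_relations s r ta tb dt lam dW H' E'"
    and sym: "symplectic_condition r ta tb"
    and k: "k \<in> {1..s}" and l: "l \<in> {1..s}" and n: "n \<in> {1..s}"
  shows "(t1 E k l n \<bullet> t1 H' k l n - t1 E' k l n \<bullet> t1 H k l n)
       - (t0 E k l n \<bullet> t0 H' k l n - t0 E' k l n \<bullet> t0 H k l n) =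
    - dt * (\<Sum>m=1..r. tb m *
        (flux_density D1 del_x H H' m k l n + flux_density D1 del_x E E' m k l n
       + (flux_density D2 del_y H H' m k l n + flux_density D2 del_y E E' m k l n)
       + (flux_density D3 del_z H H' m k l n + flux_density D3 del_z E E' m k l n)))"
proof -
  \<comment> \<open>Stated for arbitrary pairs of solutions because it is needed again with the two
    solutions exchanged. The minus sign in the equation for \<open>H'\<close> is absorbed into the
    slope, so that both fields have the common form with step \<open>dt\<close>.\<close>
  have bar: "t1_bar E k l n \<bullet> t1_bar H' k l n - t0 E k l n \<bullet> t0 H' k l n =
      dt * (\<Sum>m=1..r. tb m * (discrete_curl H m k l n \<bullet> stage H' m k l n
        + stage E m k l n \<bullet> (- discrete_curl E' m k l n)))"
    if "temporal_relations s r ta tb dt lam dW H E" "temporal_relations s r ta tb dt lam dW H' E'"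
    for H E H' E'
    by (subst bilinear_symplectic_RK_increment[OF bounded_bilinear_inner sym,
          where f = "\<lambda>m. discrete_curl H m k l n" and g = "\<lambda>m. - discrete_curl E' m k l n"
            and x = "\<lambda>m. stage E m k l n" and y = "\<lambda>m. stage H' m k l n" and h = dt])
      (use that k l n in \<open>simp_all add: temporal_relations_def sum_negf\<close>)
  have noise: "t1 E k l n = t1_bar E k l n - (lam * dW k l n) *\<^sub>R t1_bar H k l n"
      "t1 H k l n = t1_bar H k l n + (lam * dW k l n) *\<^sub>R t1 E k l n"
    if "temporal_relations s r ta tb dt lam dW H E" for H E
    using that k l n by (simp_all add: temporal_relations_def)
  \<comment> \<open>The two shears are undone in reverse order. Each adds a multiple of a symmetric
    product, first of \<open>t1 E\<close> with \<open>t1 E'\<close> and then of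
    \<open>t1_bar H\<close> with \<open>t1_bar H'\<close>, which cancels in the antisymmetric
    difference.\<close>
  have "t1 E k l n \<bullet> t1 H' k l n - t1 E' k l n \<bullet> t1 H k l n =
      t1 E k l n \<bullet> t1_bar H' k l n - t1 E' k l n \<bullet> t1_bar H k l n"
    by (simp add: noise(2)[OF U] noise(2)[OF V] inner_add_right inner_commute)
  also have "\<dots> = t1_bar E k l n \<bullet> t1_bar H' k l n - t1_bar E' k l n \<bullet> t1_bar H k l n"
    by (simp add: noise(1)[OF U] noise(1)[OF V] inner_diff_left inner_diff_right inner_commute)
  finally have "(t1 E k l n \<bullet> t1 H' k l n - t1 E' k l n \<bullet> t1 H k l n)
       - (t0 E k l n \<bullet> t0 H' k l n - t0 E' k l n \<bullet> t0 H k l n) =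
      dt * (\<Sum>m=1..r. tb m * (discrete_curl H m k l n \<bullet> stage H' m k l n
        + stage E m k l n \<bullet> (- discrete_curl E' m k l n)))
    - dt * (\<Sum>m=1..r. tb m * (discrete_curl H' m k l n \<bullet> stage H m k l n
        + stage E' m k l n \<bullet> (- discrete_curl E m k l n)))"
    using bar[OF U V] bar[OF V U] by simp
  also have "\<dots> = - dt * (\<Sum>m=1..r. tb m *
        (flux_density D1 del_x H H' m k l n + flux_density D1 del_x E E' m k l n
       + (flux_density D2 del_y H H' m k l n + flux_density D2 del_y E E' m k l n)
       + (flux_density D3 del_z H H' m k l n + flux_density D3 del_z E E' m k l n)))"
  proof -
    \<comment> \<open>Moving the matrices off the stage derivatives of the unprimed fields onto the
      primed stages turns the four curl pairings into minus the flux densities, stage by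
      stage.\<close>
    have sk: "(A *v x) \<bullet> y = - (x \<bullet> (A *v y))" if "A \<in> {D1, D2, D3}" for A x y
      using that skew_matrix_D by (auto simp: skew_matrix_def)
    have "tb m * (discrete_curl H m k l n \<bullet> stage H' m k l n
          + stage E m k l n \<bullet> (- discrete_curl E' m k l n))
        - tb m * (discrete_curl H' m k l n \<bullet> stage H m k l n
          + stage E' m k l n \<bullet> (- discrete_curl E m k l n)) =
        - (tb m * (flux_density D1 del_x H H' m k l n + flux_density D1 del_x E E' m k l n
          + (flux_density D2 del_y H H' m k l n + flux_density D2 del_y E E' m k l n)
          + (flux_density D3 del_z H H' m k l n + flux_density D3 del_z E E' m k l n)))" for m
      unfolding flux_density_def discrete_curl_def inner_add_left inner_add_right inner_minus_right
        inner_commute[of "stage E' m k l n"] inner_commute[of "_ *v _" "stage H m k l n"]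
      by (simp add: sk algebra_simps)
    thus ?thesis
      by (simp only: right_diff_distrib[symmetric] sum_subtractf[symmetric] sum_negf
          mult_minus_left mult_minus_right)
  qed
  finally show ?thesis .
qed

section \<open>Exterior forms as inner products of differentials\<close>

lemma differential_component:
  assumes "(X has_derivative X') (at p)"
  shows "differential (\<lambda>q. X q $ i) p u = X' u $ i"
proof -
  have "((\<lambda>q. X q $ i) has_derivative (\<lambda>u. X' u $ i)) (at p)"
    by (rule bounded_linear.has_derivative[OF bounded_linear_vec_nth assms])
  thus ?thesis
    by (metis differential_def frechet_derivative_at)
qed

lemma dwedge_eq_inner:
  assumes "(X has_derivative X') (at p)" "(Y has_derivative Y') (at p)"
  shows "dwedge X Y p u v = X' u \<bullet> Y' v - X' v \<bullet> Y' u"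
  by (simp add: dwedge_def wedge_def differential_component[OF assms(1)]
      differential_component[OF assms(2)] inner_vec_def sum_subtractf)

lemma dwedge_mat_eq_inner:
  assumes "(X has_derivative X') (at p)"
  shows "dwedge_mat A X p u v = X' u \<bullet> (A *v X' v) - X' v \<bullet> (A *v X' u)"
  by (simp add: dwedge_mat_def wedge_def differential_component[OF assms] inner_vec_def
      matrix_vector_mult_def sum_distrib_left algebra_simps sum_subtractf)

lemma sum_UNIV_Plus:
  "(\<Sum>p\<in>(UNIV :: ('a::finite + 'b::finite) set). f p) = (\<Sum>i\<in>UNIV. f (Inl i)) + (\<Sum>j\<in>UNIV. f (Inr j))"
  unfolding UNIV_Plus_UNIV[symmetric] by (subst sum.Plus) simp_all

lemma inner_block_diag:
  "stack h e \<bullet> (block_diag A *v stack h' e') = h \<bullet> (A *v h') + e \<bullet> (A *v e')"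
  by (simp add: inner_vec_def matrix_vector_mult_def sum_UNIV_Plus stack_def block_diag_def)

lemma stack_has_derivative:
  assumes "(h has_derivative h') (at p)" "(e has_derivative e') (at p)"
  shows "((\<lambda>q. stack (h q) (e q)) has_derivative (\<lambda>u. stack (h' u) (e' u))) (at p)"
proof -
  have "((\<lambda>q. stack (h q) (e q) $ i) has_derivative (\<lambda>u. stack (h' u) (e' u) $ i)) (at p)" for i
    using assms by (cases i)
      (simp_all add: stack_def bounded_linear.has_derivative[OF bounded_linear_vec_nth])
  thus ?thesis
    unfolding has_derivative_componentwise_within[of "\<lambda>q. stack (h q) (e q)"]
    by (auto simp: Basis_vec_def inner_axis)
qed

text \<open>By skewness the two terms of the antisymmetrization coincide. The resulting factor 2 is
  what the factors \<open>1 / (2 * dx)\<close> and their analogues in the conservation law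
  compensate.\<close>

lemma dwedge_mat_stack_at:
  assumes A: "skew_matrix A"
    and "((\<lambda>q. F (H q) m i j) has_derivative (\<lambda>u. F (field_differential H p u) m i j)) (at p)"
    and "((\<lambda>q. F (E q) m i j) has_derivative (\<lambda>u. F (field_differential E p u) m i j)) (at p)"
  shows "dwedge_mat (block_diag A) (stack_at F H E m i j) p u v =
    2 * (F (field_differential H p u) m i j \<bullet> (A *v F (field_differential H p v) m i j)
       + F (field_differential E p u) m i j \<bullet> (A *v F (field_differential E p v) m i j))"
proof -
  have sk: "x \<bullet> (A *v y) = - (y \<bullet> (A *v x))" for x y
    using A by (metis skew_matrix_def inner_commute)
  show ?thesis
    unfolding stack_at_def dwedge_mat_eq_inner[OF stack_has_derivative[OF assms(2,3)]]
      inner_block_diag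
    using sk[of "F (field_differential H p v) m i j" "F (field_differential H p u) m i j"]
      sk[of "F (field_differential E p v) m i j" "F (field_differential E p u) m i j"]
    by simp
qed

section \<open>The conservation law for one realization and almost surely\<close>

text \<open>All four sums reduce to quadratures of three stage densities with the same weights: the
  temporal sum gives minus all three, and each spatial sum gives back one of them.\<close>

lemma multisymplectic_conservation:
  fixes H E :: "'p::real_normed_vector \<Rightarrow> cell_field"
  assumes P: "open P" "p \<in> P"
    and scheme: "\<And>q. q \<in> P \<Longrightarrow> splitting_RK_scheme s r a b ta tb dx dy dz dt lam dW (H q) (E q)"
    and diff: "depends_differentiably s r H p" "depends_differentiably s r E p"
    and sym: "symplectic_condition s (a 1) (b 1)" "symplectic_condition s (a 2) (b 2)"
      "symplectic_condition s (a 3) (b 3)" "symplectic_condition r ta tb"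
    and nz: "dx \<noteq> 0" "dy \<noteq> 0" "dz \<noteq> 0" "dt \<noteq> 0"
  shows "1 / dt * (\<Sum>k=1..s. \<Sum>l=1..s. \<Sum>n=1..s. b 1 k * b 2 l * b 3 n *
          (dwedge (\<lambda>q. t1 (E q) k l n) (\<lambda>q. t1 (H q) k l n) p u v
         - dwedge (\<lambda>q. t0 (E q) k l n) (\<lambda>q. t0 (H q) k l n) p u v))
    + 1 / (2 * dx) * (\<Sum>m=1..r. \<Sum>l=1..s. \<Sum>n=1..s. tb m * b 2 l * b 3 n *
          (dwedge_mat K1 (stack_at x1 H E m l n) p u v - dwedge_mat K1 (stack_at x0 H E m l n) p u v))
    + 1 / (2 * dy) * (\<Sum>m=1..r. \<Sum>k=1..s. \<Sum>n=1..s. tb m * b 1 k * b 3 n *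
          (dwedge_mat K2 (stack_at y1 H E m k n) p u v - dwedge_mat K2 (stack_at y0 H E m k n) p u v))
    + 1 / (2 * dz) * (\<Sum>m=1..r. \<Sum>k=1..s. \<Sum>l=1..s. tb m * b 1 k * b 2 l *
          (dwedge_mat K3 (stack_at z1 H E m k l) p u v - dwedge_mat K3 (stack_at z0 H E m k l) p u v))
    = 0" (is "?T + ?X + ?Y + ?Z = 0")
proof -
  define dH where "dH = field_differential H p"
  define dE where "dE = field_differential E p"
  note t = depends_differentiably_timeD
  have sp: "spatial_relations s r a b dx dy dz (dH w)" "spatial_relations s r a b dx dy dz (dE w)"
    and tm: "temporal_relations s r ta tb dt lam dW (dH w) (dE w)" for w
    unfolding dH_def dE_def using scheme
    by (auto intro!: spatial_relations_field_differential[OF P]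
        temporal_relations_field_differential[OF P] diff simp: splitting_RK_scheme_def)
  \<comment> \<open>\<open>G1\<close>, \<open>G2\<close>, \<open>G3\<close> discretize the x-, y-
    and z-derivatives of half the forms \<open>dU \<and> K1 dU\<close>,
    \<open>dU \<and> K2 dU\<close>, \<open>dU \<and> K3 dU\<close> on \<open>u\<close>,
    \<open>v\<close>.\<close>
  define G1 where "G1 m k l n = flux_density D1 del_x (dH u) (dH v) m k l n
      + flux_density D1 del_x (dE u) (dE v) m k l n" for m k l n
  define G2 where "G2 m k l n = flux_density D2 del_y (dH u) (dH v) m k l n
      + flux_density D2 del_y (dE u) (dE v) m k l n" for m k l n
  define G3 where "G3 m k l n = flux_density D3 del_z (dH u) (dH v) m k l n
      + flux_density D3 del_z (dE u) (dE v) m k l n" for m k l n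
  have T: "dwedge (\<lambda>q. t1 (E q) k l n) (\<lambda>q. t1 (H q) k l n) p u v
         - dwedge (\<lambda>q. t0 (E q) k l n) (\<lambda>q. t0 (H q) k l n) p u v =
      - dt * (\<Sum>m=1..r. tb m * (G1 m k l n + G2 m k l n + G3 m k l n))"
    if "k \<in> {1..s}" "l \<in> {1..s}" "n \<in> {1..s}" for k l n
    unfolding G1_def G2_def G3_def temporal_wedge_increment[OF tm tm sym(4) that, symmetric]
    by (simp only: dH_def dE_def dwedge_eq_inner[OF t(1)[OF diff(2) that] t(1)[OF diff(1) that]]
        dwedge_eq_inner[OF t(2)[OF diff(2) that] t(2)[OF diff(1) that]])
  have X: "dwedge_mat K1 (stack_at x1 H E m l n) p u v - dwedge_mat K1 (stack_at x0 H E m l n) p u v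
      = 2 * dx * (\<Sum>k=1..s. b 1 k * G1 m k l n)"
    and Y: "dwedge_mat K2 (stack_at y1 H E m l n) p u v - dwedge_mat K2 (stack_at y0 H E m l n) p u v
      = 2 * dy * (\<Sum>k=1..s. b 2 k * G2 m l k n)"
    and Z: "dwedge_mat K3 (stack_at z1 H E m l n) p u v - dwedge_mat K3 (stack_at z0 H E m l n) p u v
      = 2 * dz * (\<Sum>k=1..s. b 3 k * G3 m l n k)"
    if m: "m \<in> {1..r}" and l: "l \<in> {1..s}" and n: "n \<in> {1..s}" for m l n
  proof -
    \<comment> \<open>Boundary values drop the index of their own direction. The triple
      \<open>l l n\<close> yields the pair \<open>l n\<close> for the x- and y-faces, and
      \<open>l n n\<close> yields it for the y- and z-faces.\<close>
    note D = depends_differentiablyD[OF diff(1) m l l n] depends_differentiablyD[OF diff(1) m l n n]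
      depends_differentiablyD[OF diff(2) m l l n] depends_differentiablyD[OF diff(2) m l n n]
    note inc = spatial_flux_increments[OF sp(1)[of u] sp(1)[of v] sym(1,2,3) m l n]
      spatial_flux_increments[OF sp(2)[of u] sp(2)[of v] sym(1,2,3) m l n]
    show "dwedge_mat K1 (stack_at x1 H E m l n) p u v - dwedge_mat K1 (stack_at x0 H E m l n) p u v
      = 2 * dx * (\<Sum>k=1..s. b 1 k * G1 m k l n)"
      using inc(1,4)
      by (simp add: K1_def dwedge_mat_stack_at[OF skew_matrix_D(1)] D G1_def dH_def dE_def
          distrib_left sum.distrib)
    show "dwedge_mat K2 (stack_at y1 H E m l n) p u v - dwedge_mat K2 (stack_at y0 H E m l n) p u v
      = 2 * dy * (\<Sum>k=1..s. b 2 k * G2 m l k n)"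
      using inc(2,5)
      by (simp add: K2_def dwedge_mat_stack_at[OF skew_matrix_D(2)] D G2_def dH_def dE_def
          distrib_left sum.distrib)
    show "dwedge_mat K3 (stack_at z1 H E m l n) p u v - dwedge_mat K3 (stack_at z0 H E m l n) p u v
      = 2 * dz * (\<Sum>k=1..s. b 3 k * G3 m l n k)"
      using inc(3,6)
      by (simp add: K3_def dwedge_mat_stack_at[OF skew_matrix_D(3)] D G3_def dH_def dE_def
          distrib_left sum.distrib)
  qed
  \<comment> \<open>The common weight: each sum in the law lacks one of the four factors, and the
    quadrature in the corresponding increment supplies it.\<close>
  define c where "c m k l n = tb m * b 1 k * b 2 l * b 3 n" for m k l n
  have "?T = 1 / dt * (\<Sum>k=1..s. \<Sum>l=1..s. \<Sum>n=1..s. b 1 k * b 2 l * b 3 n *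
      (- dt * (\<Sum>m=1..r. tb m * (G1 m k l n + G2 m k l n + G3 m k l n))))"
    by (intro arg_cong2[where f = "(*)"] sum.cong refl T)
  also have "\<dots> = - (\<Sum>k=1..s. \<Sum>l=1..s. \<Sum>n=1..s. \<Sum>m=1..r.
      c m k l n * (G1 m k l n + G2 m k l n + G3 m k l n))"
    using nz by (simp add: sum_distrib_left sum_negf c_def mult_ac)
  also have "\<dots> = - (\<Sum>m=1..r. \<Sum>k=1..s. \<Sum>l=1..s. \<Sum>n=1..s.
      c m k l n * (G1 m k l n + G2 m k l n + G3 m k l n))"
    \<comment> \<open>Fixing the inner range to \<open>{1..r}\<close> makes the rewriting carry the
      sum over \<open>m\<close> outwards past the spatial sums.\<close>
    by (simp only: sum.swap[of _ "{1..r}"])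
  finally have T': "?T = - (\<Sum>m=1..r. \<Sum>k=1..s. \<Sum>l=1..s. \<Sum>n=1..s. c m k l n * G1 m k l n)
      - (\<Sum>m=1..r. \<Sum>k=1..s. \<Sum>l=1..s. \<Sum>n=1..s. c m k l n * G2 m k l n)
      - (\<Sum>m=1..r. \<Sum>k=1..s. \<Sum>l=1..s. \<Sum>n=1..s. c m k l n * G3 m k l n)"
    by (simp add: distrib_left sum.distrib)
  have "?X = 1 / (2 * dx) * (\<Sum>m=1..r. \<Sum>l=1..s. \<Sum>n=1..s. tb m * b 2 l * b 3 n *
      (2 * dx * (\<Sum>k=1..s. b 1 k * G1 m k l n)))"
    by (intro arg_cong2[where f = "(*)"] sum.cong refl X)
  also have "\<dots> = (\<Sum>m=1..r. \<Sum>l=1..s. \<Sum>n=1..s. \<Sum>k=1..s. c m k l n * G1 m k l n)"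
    using nz by (simp add: sum_distrib_left c_def mult_ac)
  also have "\<dots> = (\<Sum>m=1..r. \<Sum>l=1..s. \<Sum>k=1..s. \<Sum>n=1..s. c m k l n * G1 m k l n)"
    by (intro sum.cong refl sum.swap)
  also have "\<dots> = (\<Sum>m=1..r. \<Sum>k=1..s. \<Sum>l=1..s. \<Sum>n=1..s. c m k l n * G1 m k l n)"
    by (intro sum.cong refl sum.swap)
  finally have X': "?X = \<dots>" .
  have "?Y = 1 / (2 * dy) * (\<Sum>m=1..r. \<Sum>k=1..s. \<Sum>n=1..s. tb m * b 1 k * b 3 n *
      (2 * dy * (\<Sum>l=1..s. b 2 l * G2 m k l n)))"
    by (intro arg_cong2[where f = "(*)"] sum.cong refl Y)
  also have "\<dots> = (\<Sum>m=1..r. \<Sum>k=1..s. \<Sum>n=1..s. \<Sum>l=1..s. c m k l n * G2 m k l n)"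
    using nz by (simp add: sum_distrib_left c_def mult_ac)
  also have "\<dots> = (\<Sum>m=1..r. \<Sum>k=1..s. \<Sum>l=1..s. \<Sum>n=1..s. c m k l n * G2 m k l n)"
    by (intro sum.cong refl sum.swap)
  finally have Y': "?Y = \<dots>" .
  have "?Z = 1 / (2 * dz) * (\<Sum>m=1..r. \<Sum>k=1..s. \<Sum>l=1..s. tb m * b 1 k * b 2 l *
      (2 * dz * (\<Sum>n=1..s. b 3 n * G3 m k l n)))"
    by (intro arg_cong2[where f = "(*)"] sum.cong refl Z)
  also have "\<dots> = (\<Sum>m=1..r. \<Sum>k=1..s. \<Sum>l=1..s. \<Sum>n=1..s. c m k l n * G3 m k l n)"
    using nz by (simp add: sum_distrib_left c_def mult_ac)
  finally have Z': "?Z = \<dots>" .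
  show ?thesis unfolding T' X' Y' Z' by simp
qed

theorem theorem4p5:
  fixes M :: "'w measure"
    and D :: "(real^3) set"
    and Q :: "(real^3 \<Rightarrow> real) \<Rightarrow> (real^3 \<Rightarrow> real)"
    and W :: "real \<Rightarrow> 'w \<Rightarrow> real^3 \<Rightarrow> real"
    and s r :: nat
    and lam dx dy dz dt :: real
    and a :: "nat \<Rightarrow> nat \<Rightarrow> nat \<Rightarrow> real"
    and b :: "nat \<Rightarrow> nat \<Rightarrow> real"
    and ta :: "nat \<Rightarrow> nat \<Rightarrow> real"
    and tb :: "nat \<Rightarrow> real"
    and P :: "'p::real_normed_vector set"
    and H E :: "'w \<Rightarrow> 'p \<Rightarrow> cell_field"
  assumes "prob_space M"
    and "D \<in> sets lebesgue"
    and "trace_class_covariance D Q"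
    and "Q_Wiener_process M D Q W"
    and "s \<ge> 1" and "r \<ge> 1"
    and "dx > 0" and "dy > 0" and "dz > 0" and "dt > 0"
    and "open P"
    and scheme: "AE \<omega> in M. \<forall>p\<in>P.
          splitting_RK_scheme s r a b ta tb dx dy dz dt lam
            (noise_increment W s a dx dy dz dt \<omega>) (H \<omega> p) (E \<omega> p)"
    and smooth: "AE \<omega> in M. \<forall>p\<in>P.
          depends_differentiably s r (H \<omega>) p \<and> depends_differentiably s r (E \<omega>) p"
    and "\<forall>d\<in>{1, 2, 3}. symplectic_condition s (a d) (b d)"
    and "symplectic_condition r ta tb"
  shows "AE \<omega> in M. \<forall>p\<in>P. \<forall>u v.
      1 / dt * (\<Sum>k=1..s. \<Sum>l=1..s. \<Sum>n=1..s. b 1 k * b 2 l * b 3 n *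
          (dwedge (\<lambda>q. t1 (E \<omega> q) k l n) (\<lambda>q. t1 (H \<omega> q) k l n) p u v
         - dwedge (\<lambda>q. t0 (E \<omega> q) k l n) (\<lambda>q. t0 (H \<omega> q) k l n) p u v))
    + 1 / (2 * dx) * (\<Sum>m=1..r. \<Sum>l=1..s. \<Sum>n=1..s. tb m * b 2 l * b 3 n *
          (dwedge_mat K1 (stack_at x1 (H \<omega>) (E \<omega>) m l n) p u v - dwedge_mat K1 (stack_at x0 (H \<omega>) (E \<omega>) m l n) p u v))
    + 1 / (2 * dy) * (\<Sum>m=1..r. \<Sum>k=1..s. \<Sum>n=1..s. tb m * b 1 k * b 3 n *
          (dwedge_mat K2 (stack_at y1 (H \<omega>) (E \<omega>) m k n) p u v - dwedge_mat K2 (stack_at y0 (H \<omega>) (E \<omega>) m k n) p u v))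
    + 1 / (2 * dz) * (\<Sum>m=1..r. \<Sum>k=1..s. \<Sum>l=1..s. tb m * b 1 k * b 2 l *
          (dwedge_mat K3 (stack_at z1 (H \<omega>) (E \<omega>) m k l) p u v - dwedge_mat K3 (stack_at z0 (H \<omega>) (E \<omega>) m k l) p u v))
    = 0"
  using scheme smooth
proof eventually_elim
  \<comment> \<open>The quantifiers over \<open>p\<close>, \<open>u\<close>, \<open>v\<close> stand
    inside the almost-sure statements, so one null set serves for all of them. Off it the noise
    increments are fixed reals, constant in the parameter, and the pathwise law applies.\<close>
  case (elim \<omega>)
  with assms show ?case
    by (intro ballI allI multisymplectic_conservation[where P = P and ta = ta and lam = lam
          and dW = "noise_increment W s a dx dy dz dt \<omega>"]) auto
qed

end
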